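(* There is a randomized algorithm that, given $\varepsilon\in(0,1)$, uses only the $\mathbf{RandVert}$, $\mathbf{RandNbr}$, $\mathbf{RandEdge}$ and $\mathbf{Degree}$ oracles and no knowledge of $n$. It returns a $(1\pm\varepsilon)$-approximation to $d$ using $O(\varepsilon^{-2.5}\sqrt{n/d})$ queries. Moreover, there is also such an algorithm using $O(\varepsilon^{-2}\sqrt{n/d})$ queries.
   Context: $G=(V,E)$ is an unknown simple undirected graph with $n=|V|$ vertices and $m=|E|$ edges, no isolated vertices, and average degree $d=2m/n$. The oracles, each of unit cost, are: - $\mathbf{RandVert}()$ returns a uniformly random vertex. - $\mathbf{RandNbr}(x)$ returns a uniformly random neighbor of $x$. - $\mathbf{Degree}(x)$ returns $\deg(x)$. - $\mathbf{RandEdge}()$ returns a uniformly random edge. Vertices have distinct identifiers from a totally ordered universe that reveal nothing about $n$. A $(1\pm\varepsilon)$-approximation to $d$ is a value in $[(1-\varepsilon)d,(1+\varepsilon)d]$. The guarantee holds with constant probability bounded away from $1/2$, and the query bounds are on the expected number of queries. *)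

theory Defs
  imports "HOL-Probability.SPMF"
begin

definition simple_graph :: "'v set \<Rightarrow> 'v set set \<Rightarrow> bool" where
  "simple_graph V E \<longleftrightarrow> finite V \<and> V \<noteq> {} \<and> (\<forall>e\<in>E. e \<subseteq> V \<and> card e = 2)"

definition neighbors :: "'v set set \<Rightarrow> 'v \<Rightarrow> 'v set" where
  "neighbors E x = {y. {x, y} \<in> E}"

definition deg :: "'v set set \<Rightarrow> 'v \<Rightarrow> nat" where
  "deg E x = card (neighbors E x)"

definition no_isolated :: "'v set \<Rightarrow> 'v set set \<Rightarrow> bool" where
  "no_isolated V E \<longleftrightarrow> (\<forall>x\<in>V. neighbors E x \<noteq> {})"

definition avg_degree :: "'v set \<Rightarrow> 'v set set \<Rightarrow> real" where
  "avg_degree V E = 2 * real (card E) / real (card V)"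

text \<open>
  A randomized query algorithm is a possibly infinite interaction tree. At each node it draws,
  from a discrete distribution that models its private coins, either a final output or one oracle
  query together with its continuation on the answer. The tree does not mention the graph, so the
  algorithm learns about the graph, and about its number of vertices, only from the answers. Edges
  are answered as unordered pairs. Infinite branches are allowed because only the expected number
  of queries is to be bounded.
\<close>

datatype ('v, 'k) action =
    Output real
  | RandVert "'v \<Rightarrow> 'k"
  | RandNbr 'v "'v \<Rightarrow> 'k"
  | RandEdge "'v set \<Rightarrow> 'k"
  | Degree 'v "nat \<Rightarrow> 'k"

codatatype 'v algorithm = Algorithm (action: "('v, 'v algorithm) action pmf")

text \<open>
  The joint distribution of the output and the number of queries made. The missing mass is the
  probability of not halting. A query about an identifier that is not a vertex never returns, so an
  algorithm that halts almost surely on all graphs cannot probe the (infinite) universe of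
  identifiers for vertices it has not been given.
\<close>

partial_function (spmf) run ::
    "'v set \<Rightarrow> 'v set set \<Rightarrow> 'v algorithm \<Rightarrow> (real \<times> nat) spmf" where
  "run V E A =
     bind_spmf (spmf_of_pmf (action A)) (\<lambda>act. case act of
         Output r \<Rightarrow> return_spmf (r, 0)
       | RandVert k \<Rightarrow>
           bind_spmf (spmf_of_set V) (\<lambda>v. map_spmf (apsnd Suc) (run V E (k v)))
       | RandNbr x k \<Rightarrow>
           if x \<in> V
           then bind_spmf (spmf_of_set (neighbors E x)) (\<lambda>y. map_spmf (apsnd Suc) (run V E (k y)))
           else return_pmf None
       | RandEdge k \<Rightarrow>
           bind_spmf (spmf_of_set E) (\<lambda>e. map_spmf (apsnd Suc) (run V E (k e)))
       | Degree x k \<Rightarrow>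
           if x \<in> V then map_spmf (apsnd Suc) (run V E (k (deg E x))) else return_pmf None)"

definition success_prob :: "real \<Rightarrow> 'v set \<Rightarrow> 'v set set \<Rightarrow> 'v algorithm \<Rightarrow> real" where
  "success_prob \<epsilon> V E A =
     measure (measure_spmf (run V E A))
       {(r, q). r \<in> {(1 - \<epsilon>) * avg_degree V E .. (1 + \<epsilon>) * avg_degree V E}}"

text \<open>Runs that do not halt contribute nothing here, so this is the expected number of queries
  only for an algorithm that halts almost surely.\<close>

definition expected_queries :: "'v set \<Rightarrow> 'v set set \<Rightarrow> 'v algorithm \<Rightarrow> ennreal" where
  "expected_queries V E A = (\<integral>\<^sup>+ (r, q). of_nat q \<partial>measure_spmf (run V E A))"

text \<open>
  The family is indexed by the accuracy parameter only. The success probability and the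
  constant of the query bound are uniform in the accuracy and in the graph, and the vertex set is
  an arbitrary finite set of identifiers, so that identifiers carry no information on its size.
\<close>

definition estimates_avg_degree_within ::
    "(real \<Rightarrow> 'v::linorder algorithm) \<Rightarrow> (real \<Rightarrow> real \<Rightarrow> real \<Rightarrow> real) \<Rightarrow> bool" where
  "estimates_avg_degree_within A bound \<longleftrightarrow>
     (\<exists>p > 1/2. \<exists>C > 0. \<forall>\<epsilon> V E.
        0 < \<epsilon> \<and> \<epsilon> < 1 \<and> simple_graph V E \<and> no_isolated V E \<longrightarrow>
          lossless_spmf (run V E (A \<epsilon>)) \<and>
          success_prob \<epsilon> V E (A \<epsilon>) \<ge> p \<and>
          expected_queries V E (A \<epsilon>) \<le>
            ennreal (C * bound \<epsilon> (real (card V)) (avg_degree V E)))"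

end

theory Submission
  imports Defs
begin

text \<open>
  Let \<open>Y\<close> be the smaller degree of the endpoints of a random edge. For a random vertex \<open>v\<close> with a
  random neighbour \<open>u\<close>, the variable \<open>X = 2 deg v\<close> if \<open>deg v < deg u\<close>, \<open>X = deg v\<close> if the degrees
  agree and \<open>X = 0\<close> otherwise is an unbiased estimator of \<open>d\<close>. Replacing \<open>deg v\<close> by \<open>min (deg v) t\<close>
  multiplies its mean by \<open>E (min Y t / Y)\<close>, which is at least \<open>1 - E (min Y t) / t\<close>, and bounds its
  second moment by \<open>2 d E (min Y t)\<close>.

  Take for \<open>t\<close> the sum of \<open>32 / \<epsilon>\<close> independent copies of \<open>Y\<close>. Then \<open>E (min Y t) < \<epsilon> t / 4\<close> with large
  constant probability, so that both the bias of the capped variable and its variance are under control, and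
  sampling until the sum of the capped variables reaches \<open>\<theta> = 40 t / \<epsilon>\<close> takes about \<open>\<theta> / d\<close> rounds by
  Chebyshev's inequality. No bound on \<open>n\<close> or \<open>d\<close> enters. The expected number of rounds is
  \<open>O(t / \<epsilon>)\<close> over the mean of the capped variable, which for every value of \<open>t\<close> is
  \<open>O((t + E Y) / (\<epsilon> d))\<close>. As \<open>E Y = O(sqrt m)\<close> and \<open>E t = O(E Y / \<epsilon>)\<close>, the cost is
  \<open>O(\<epsilon> powr (-2) * sqrt (n / d))\<close>. The first bound of the theorem is weaker than this one.
\<close>

section \<open>Halting and the expected number of queries\<close>

text \<open>A run that does not halt is charged the full cap, so that a bound uniform in the cap yields
  almost sure halting as well as a bound on the expected number of queries.\<close>

definition capped_cost :: "nat \<Rightarrow> (real \<times> nat) spmf \<Rightarrow> ennreal" where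
  "capped_cost k p =
     (\<integral>\<^sup>+ z. (case z of None \<Rightarrow> of_nat k | Some (_, q) \<Rightarrow> of_nat (min q k)) \<partial>measure_pmf p)"

text \<open>Taking \<open>j\<close> queries out of the count lowers the cap by \<open>j\<close>, so
  recursions of runs that may not halt can be closed by induction on the cap. Truncated subtraction
  leaves only \<open>\<le>\<close> when \<open>k < j\<close>.\<close>

lemma capped_cost_add_queries:
  "capped_cost k (map_spmf (apsnd ((+) j)) p) \<le> of_nat j + capped_cost (k - j) p"
proof -
  have "capped_cost k (map_spmf (apsnd ((+) j)) p) \<le>
      (\<integral>\<^sup>+ z. of_nat j + (case z of None \<Rightarrow> of_nat (k - j) | Some (_, q) \<Rightarrow> of_nat (min q (k - j)))
        \<partial>measure_pmf p)"
    unfolding capped_cost_def nn_integral_map_pmf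
  proof (intro nn_integral_mono)
    fix z :: "(real \<times> nat) option"
    have *: "k \<le> j + (k - j)" "\<And>q. min (j + q) k \<le> j + min q (k - j)" by auto
    have **: "a \<le> j + b \<Longrightarrow> (of_nat a :: ennreal) \<le> of_nat j + of_nat b" for a b
      by (simp flip: of_nat_add)
    show "(case map_option (apsnd ((+) j)) z of None \<Rightarrow> of_nat k | Some (_, q) \<Rightarrow> of_nat (min q k))
      \<le> of_nat j + (case z of None \<Rightarrow> of_nat (k - j) | Some (_, q) \<Rightarrow> (of_nat (min q (k - j)) :: ennreal))"
      by (cases z) (auto simp: apsnd_def split: prod.split intro!: ** *)
  qed
  also have "\<dots> = of_nat j + capped_cost (k - j) p"
    unfolding capped_cost_def by (subst nn_integral_add) (auto simp: measure_pmf.emeasure_space_1)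
  finally show ?thesis .
qed

lemma capped_cost_bind:
  "capped_cost k (bind_pmf D f) = (\<integral>\<^sup>+ x. capped_cost k (f x) \<partial>measure_pmf D)"
  unfolding capped_cost_def by simp

text \<open>Not halting contributes \<open>k * pmf p None\<close>, which is unbounded in
  \<open>k\<close> unless \<open>None\<close> has no mass.\<close>

lemma lossless_if_capped_cost_bounded:
  assumes "\<And>k. capped_cost k p \<le> ennreal c"
  shows "lossless_spmf p"
proof (rule ccontr)
  assume "\<not> lossless_spmf p"
  then have pos: "pmf p None > 0"
    by (simp add: lossless_iff_pmf_None order.not_eq_order_implies_strict)
  have le: "real k * pmf p None \<le> max c 0" for k
  proof -
    have "ennreal (real k * pmf p None) = (\<integral>\<^sup>+ z. of_nat k * indicator {None} z \<partial>measure_pmf p)"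
      by (subst nn_integral_cmult)
         (auto simp: emeasure_pmf_single ennreal_mult ennreal_of_nat_eq_real_of_nat)
    also have "\<dots> \<le> capped_cost k p" unfolding capped_cost_def
      by (intro nn_integral_mono) (auto split: option.split)
    also have "\<dots> \<le> ennreal (max c 0)" using assms[of k] by (auto simp: max_def ennreal_neg)
    finally show ?thesis by (subst (asm) ennreal_le_iff) auto
  qed
  obtain k :: nat where "max c 0 / pmf p None < real k" using reals_Archimedean2 by blast
  then have "max c 0 < real k * pmf p None"
    using pos by (simp only: pos_divide_less_eq)
  with le[of k] show False by linarith
qed

text \<open>Monotone convergence as the cap grows; the mass at \<open>None\<close> is
  dropped.\<close>

lemma expected_queries_le_if_capped_cost_bounded:
  assumes "\<And>k. capped_cost k (run V E A) \<le> c"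
  shows "expected_queries V E A \<le> c"
proof -
  let ?p = "run V E A"
  have "expected_queries V E A = (\<integral>\<^sup>+ z. (SUP k. of_nat (min (snd z) k)) \<partial>measure_spmf ?p)"
    unfolding expected_queries_def
  proof (intro nn_integral_cong)
    fix z :: "real \<times> nat"
    have "(SUP k. of_nat (min (snd z) k)) = (of_nat (snd z) :: ennreal)"
      by (intro antisym SUP_least SUP_upper2[of "snd z"]) (auto intro: of_nat_mono)
    then show "(case z of (r, q) \<Rightarrow> of_nat q) = (SUP k. (of_nat (min (snd z) k) :: ennreal))"
      by (simp add: case_prod_beta)
  qed
  also have "\<dots> = (SUP k. \<integral>\<^sup>+ z. of_nat (min (snd z) k) \<partial>measure_spmf ?p)"
    by (intro nn_integral_monotone_convergence_SUP) (auto simp: incseq_def le_fun_def min_def intro: of_nat_mono)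
  also have "\<dots> \<le> (SUP k. capped_cost k ?p)"
  proof (intro SUP_mono', goal_cases)
    case (1 k)
    have "(\<integral>\<^sup>+ z. of_nat (min (snd z) k) \<partial>measure_spmf ?p)
        = (\<integral>\<^sup>+ z. indicator (range Some) z * of_nat (min (snd (the z)) k) \<partial>measure_pmf ?p)"
      by (subst nn_integral_measure_spmf_conv_measure_pmf)
         (auto simp: nn_integral_restrict_space mult.commute)
    also have "\<dots> \<le> capped_cost k ?p" unfolding capped_cost_def
      by (intro nn_integral_mono) (auto split: option.split)
    finally show ?case .
  qed
  also have "\<dots> \<le> c" by (intro SUP_least assms)
  finally show ?thesis .
qed

lemma prob_bind_pmf:
  "measure_pmf.prob (bind_pmf D f) A =
     measure_pmf.expectation D (\<lambda>x. measure_pmf.prob (f x) A)"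
proof -
  have "ennreal (measure_pmf.prob (bind_pmf D f) A) = (\<integral>\<^sup>+ x. ennreal (measure_pmf.prob (f x) A) \<partial>measure_pmf D)"
    unfolding measure_pmf.emeasure_eq_measure[symmetric] by (rule emeasure_bind_pmf)
  then have "measure_pmf.prob (bind_pmf D f) A = enn2real (\<integral>\<^sup>+ x. ennreal (measure_pmf.prob (f x) A) \<partial>measure_pmf D)"
    by (metis enn2real_ennreal measure_nonneg)
  then show ?thesis by (subst integral_eq_nn_integral) auto
qed

text \<open>Events that ignore the query count, placed in the option type so that the pmf beneath a
  run measures them and not halting counts as failure.\<close>

definition outputs_in :: "real set \<Rightarrow> (real \<times> nat) option set" where
  "outputs_in G = Some ` (G \<times> UNIV)"

lemma vimage_outputs_in [simp]: "map_option (apsnd f) -` outputs_in G = outputs_in G"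
proof (intro set_eqI)
  fix z show "z \<in> map_option (apsnd f) -` outputs_in G \<longleftrightarrow> z \<in> outputs_in G"
    by (cases z) (auto simp: outputs_in_def apsnd_def image_iff)
qed

lemma Some_in_outputs_in [simp]: "Some (x, q) \<in> outputs_in G \<longleftrightarrow> x \<in> G"
  by (auto simp: outputs_in_def)

lemma success_prob_eq_prob_outputs_in:
  "success_prob \<epsilon> V E A = measure_pmf.prob (run V E A)
     (outputs_in {(1 - \<epsilon>) * avg_degree V E .. (1 + \<epsilon>) * avg_degree V E})"
  unfolding success_prob_def measure_measure_spmf_conv_measure_pmf outputs_in_def
  by (rule arg_cong[where f = "measure_pmf.prob _"]) auto

section \<open>Sampling until the sum reaches a threshold\<close>

text \<open>Here \<open>r a n\<close> is the remaining run after \<open>n\<close> samples with sum \<open>a\<close>; a sample costs four queries.\<close>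

locale stopping_rule =
  fixes D :: "real pmf" and B \<mu> v \<theta> :: real and r :: "real \<Rightarrow> nat \<Rightarrow> (real \<times> nat) spmf"
  assumes finite_support: "finite (set_pmf D)"
    and bounds: "x \<in> set_pmf D \<Longrightarrow> 0 \<le> x" "x \<in> set_pmf D \<Longrightarrow> x \<le> B"
    and mean: "measure_pmf.expectation D (\<lambda>x. x) = \<mu>" and mean_pos: "0 < \<mu>"
    and second_moment: "measure_pmf.expectation D (\<lambda>x. x\<^sup>2) \<le> v"
    and stop: "\<theta> \<le> a \<Longrightarrow> r a n = return_spmf (\<theta> / n, 0)"
    and continue: "a < \<theta> \<Longrightarrow>
      r a n = bind_pmf D (\<lambda>x. map_spmf (apsnd ((+) 4)) (r (a + x) (Suc n)))"
begin

lemma integrable [simp]: "integrable (measure_pmf D) (f :: real \<Rightarrow> real)"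
  using finite_support by (rule integrable_measure_pmf_finite)

lemma mean_le: "\<mu> \<le> B"
proof -
  have "measure_pmf.expectation D (\<lambda>x. x) \<le> measure_pmf.expectation D (\<lambda>x. B)"
    using bounds by (intro integral_mono_AE AE_pmfI integrable)
  then show ?thesis by (simp add: mean)
qed

text \<open>Wald's argument: the last sample overshoots \<theta> by at most \<open>B\<close>, so
  \<open>4 * (\<theta> + B - a) / \<mu>\<close> stays nonnegative, and its expected drop per sample
  is 4, the price of a sample.\<close>

lemma capped_cost_le:
  "a \<le> \<theta> + B \<Longrightarrow> capped_cost k (r a n) \<le> ennreal (4 * (\<theta> + B - a) / \<mu>)"
proof (induction k arbitrary: a n rule: less_induct)
  case (less k)
  show ?case
  \<comment> \<open>With \<open>k > 0\<close> the cap \<open>k - 4\<close> is smaller than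
    \<open>k\<close>, as the induction hypothesis requires.\<close>
  proof (cases "a < \<theta> \<and> k > 0")
    case False
    moreover have "capped_cost 0 (r a n) = 0"
      by (auto simp: capped_cost_def nn_integral_0_iff_AE split: option.split)
    ultimately show ?thesis using stop[of a n] by (auto simp: capped_cost_def)
  next
    case True
    have "capped_cost k (r a n) =
        (\<integral>\<^sup>+ x. capped_cost k (map_spmf (apsnd ((+) 4)) (r (a + x) (Suc n))) \<partial>measure_pmf D)"
      using True by (simp add: continue capped_cost_bind)
    also have "\<dots> \<le> (\<integral>\<^sup>+ x. ennreal (4 + 4 * (\<theta> + B - (a + x)) / \<mu>) \<partial>measure_pmf D)"
    proof (intro nn_integral_mono_AE AE_pmfI)
      fix x assume x: "x \<in> set_pmf D"
      have "capped_cost k (map_spmf (apsnd ((+) 4)) (r (a + x) (Suc n))) \<le>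
          of_nat 4 + capped_cost (k - 4) (r (a + x) (Suc n))"
        by (rule capped_cost_add_queries)
      also have "\<dots> \<le> of_nat 4 + ennreal (4 * (\<theta> + B - (a + x)) / \<mu>)"
        using True bounds[OF x] by (intro add_left_mono less.IH) auto
      also have "\<dots> = ennreal (4 + 4 * (\<theta> + B - (a + x)) / \<mu>)"
        using True bounds[OF x] mean_pos by (subst ennreal_plus) auto
      finally show "capped_cost k (map_spmf (apsnd ((+) 4)) (r (a + x) (Suc n))) \<le> \<dots>" .
    qed
    also have "\<dots> = ennreal (measure_pmf.expectation D (\<lambda>x. 4 + 4 * (\<theta> + B - (a + x)) / \<mu>))"
    proof (intro nn_integral_eq_integral AE_pmfI integrable)
      fix x assume "x \<in> set_pmf D"
      from bounds[OF this] show "0 \<le> 4 + 4 * (\<theta> + B - (a + x)) / \<mu>"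
        using True mean_pos by (intro add_nonneg_nonneg divide_nonneg_pos) auto
    qed
    also have "measure_pmf.expectation D (\<lambda>x. 4 + 4 * (\<theta> + B - (a + x)) / \<mu>)
        = measure_pmf.expectation D (\<lambda>x. (4 + 4 * (\<theta> + B - a) / \<mu>) - 4 / \<mu> * x)"
      by (intro Bochner_Integration.integral_cong) (auto simp: diff_divide_distrib add_divide_distrib algebra_simps)
    also have "\<dots> = 4 * (\<theta> + B - a) / \<mu>"
      using mean_pos by (subst Bochner_Integration.integral_diff) (auto simp: mean)
    finally show ?thesis .
  qed
qed

section \<open>Chebyshev bounds for the number of samples\<close>

lemma expectation_square_shift_le:
  "measure_pmf.expectation D (\<lambda>x. (a + x)\<^sup>2) \<le> (a + \<mu>)\<^sup>2 + v"
proof -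
  have "measure_pmf.expectation D (\<lambda>x. (a + x)\<^sup>2) = measure_pmf.expectation D (\<lambda>x. (a\<^sup>2 + (2 * a) * x) + x\<^sup>2)"
    by (intro Bochner_Integration.integral_cong) (auto simp: power2_eq_square algebra_simps)
  also have "\<dots> = a\<^sup>2 + 2 * a * \<mu> + measure_pmf.expectation D (\<lambda>x. x\<^sup>2)"
    by (subst Bochner_Integration.integral_add, simp, simp)
       (subst Bochner_Integration.integral_add, auto simp: mean)
  \<comment> \<open>The second moment stands in for the variance, at the loss of
    \<open>\<mu>\<^sup>2\<close>.\<close>
  also have "\<dots> \<le> (a + \<mu>)\<^sup>2 + v"
    using second_moment zero_le_power2[of \<mu>] unfolding power2_sum by linarith
  finally show ?thesis .
qed

text \<open>The Chebyshev bound for \<open>j\<close> further samples starting from the sum \<open>a\<close>. Viewed as a potential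
  it does not increase in expectation when a sample is drawn, and it is at least 1 once the run has
  failed; this replaces any reasoning about the distribution of the whole sequence of samples.\<close>

definition chebyshev :: "real \<Rightarrow> nat \<Rightarrow> real \<Rightarrow> real" where
  "chebyshev c j a = ((a + j * \<mu> - c)\<^sup>2 + j * v) / (\<theta> - c)\<^sup>2"

lemma v_nonneg: "0 \<le> v"
  by (rule order_trans[OF _ second_moment]) simp

text \<open>Drawing a sample replaces its mean \<open>\<mu>\<close> in the square by its value; this
  adds at most \<open>v\<close> in expectation, the term released when \<open>Suc j\<close> becomes
  \<open>j\<close>.\<close>

lemma expectation_chebyshev_le:
  "measure_pmf.expectation D (\<lambda>x. chebyshev c j (a + x)) \<le> chebyshev c (Suc j) a"
proof -
  have "measure_pmf.expectation D (\<lambda>x. chebyshev c j (a + x)) =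
      (measure_pmf.expectation D (\<lambda>x. ((a + j * \<mu> - c) + x)\<^sup>2) + j * v) / (\<theta> - c)\<^sup>2"
    unfolding chebyshev_def
    by (simp add: algebra_simps)
  also have "\<dots> \<le> (((a + j * \<mu> - c) + \<mu>)\<^sup>2 + v + j * v) / (\<theta> - c)\<^sup>2"
    by (intro divide_right_mono add_right_mono expectation_square_shift_le) auto
  also have "\<dots> = chebyshev c (Suc j) a"
    unfolding chebyshev_def by (simp add: algebra_simps)
  finally show ?thesis .
qed

lemma prob_continue:
  "a < \<theta> \<Longrightarrow> measure_pmf.prob (r a n) (outputs_in G) =
     measure_pmf.expectation D (\<lambda>x. measure_pmf.prob (r (a + x) (Suc n)) (outputs_in G))"
  by (simp add: continue prob_bind_pmf)

text \<open>With \<open>k1\<close> samples exceeded, failing means being below \<theta> after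
  \<open>k2\<close> samples, where the potential is at least 1. The disjunction excludes stopping at
  exactly \<open>k1\<close>, whose output \<open>G\<close> need not contain.\<close>

lemma prob_stops_before:
  fixes k1 k2 :: nat
  assumes "\<theta> < c" and G: "\<And>i. k1 < i \<Longrightarrow> i \<le> k2 \<Longrightarrow> \<theta> / real i \<in> G"
    and "n + j = k2" "k1 < n \<or> k1 = n \<and> a < \<theta>"
  shows "1 - chebyshev c j a \<le> measure_pmf.prob (r a n) (outputs_in G)"
  using assms(3,4)
proof (induction j arbitrary: a n)
  case (0 a n)
  have "1 \<le> chebyshev c 0 a" if "a < \<theta>"
  proof -
    have "(\<theta> - c)\<^sup>2 \<le> (a - c)\<^sup>2" 
      using that assms(1) by (intro abs_le_square_iff[THEN iffD1]) auto
    then show ?thesis using assms(1) by (simp add: chebyshev_def)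
  qed
  moreover have "0 \<le> chebyshev c 0 a" using v_nonneg by (simp add: chebyshev_def)
  ultimately show ?case using 0 G[of n]
    by (cases "a < \<theta>") (auto simp: stop indicator_def intro: order_trans[OF _ measure_nonneg])
next
  case (Suc j a n)
  show ?case
  proof (cases "a < \<theta>")
    case False
    moreover have "0 \<le> chebyshev c (Suc j) a" using v_nonneg by (simp add: chebyshev_def)
    ultimately show ?thesis using Suc.prems G[of n] by (auto simp: stop indicator_def)
  next
    case True
    have "1 - chebyshev c (Suc j) a \<le> measure_pmf.expectation D (\<lambda>x. 1 - chebyshev c j (a + x))"
      using expectation_chebyshev_le[of c j a] by simp
    also have "\<dots> \<le> measure_pmf.expectation D (\<lambda>x. measure_pmf.prob (r (a + x) (Suc n)) (outputs_in G))"
      using Suc.prems by (intro integral_mono Suc.IH integrable) auto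
    finally show ?thesis by (simp add: prob_continue True)
  qed
qed

text \<open>Two failures are possible: reaching \<theta> within \<open>k1\<close> samples, charged
  to \<open>chebyshev c1\<close>, and missing it through sample \<open>k2\<close>, charged to
  \<open>chebyshev c2\<close>. Adding the potentials is the union bound.\<close>

lemma prob_stops_between:
  fixes k1 k2 :: nat
  assumes c: "c1 < \<theta>" "\<theta> < c2" and k: "c1 = k1 * \<mu>" "k1 \<le> k2"
    and G: "\<And>i. k1 < i \<Longrightarrow> i \<le> k2 \<Longrightarrow> \<theta> / real i \<in> G"
    and "n + j = k1"
  shows "1 - chebyshev c1 j a - chebyshev c2 (k2 - n) a \<le> measure_pmf.prob (r a n) (outputs_in G)"
  using assms(6)
proof (induction j arbitrary: a n)
  have nonneg: "0 \<le> chebyshev c i a" for c i a using v_nonneg by (simp add: chebyshev_def)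
  \<comment> \<open>Further samples have positive mean, so past \<theta> the centred value is at
    least \<open>\<theta> - c1\<close>, whatever \<open>j\<close> is.\<close>
  have late: "1 \<le> chebyshev c1 j a" if "\<theta> \<le> a" for j a
  proof -
    have "(\<theta> - c1)\<^sup>2 \<le> (a + j * \<mu> - c1)\<^sup>2"
      using that c mean_pos by (intro power_mono) (auto intro: add_increasing2)
    then show ?thesis using c v_nonneg by (simp add: chebyshev_def add_increasing2)
  qed
  have stopped: "1 - chebyshev c1 j a - chebyshev c2 i a \<le> measure_pmf.prob p A" if "\<theta> \<le> a" for j i a p A
    using nonneg[of c2 i a] late[OF that, of j] measure_nonneg[of p A] by linarith
  {
    case (0 a n)
    show ?case
    proof (cases "a < \<theta>")
      case True
      have "1 - chebyshev c2 (k2 - n) a \<le> measure_pmf.prob (r a n) (outputs_in G)"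
        using 0 k True by (intro prob_stops_before[where ?k1.0 = k1 and ?k2.0 = k2] c G) auto
      then show ?thesis using nonneg[of c1 0 a] by linarith
    qed (auto intro!: stopped)
  next
    case (Suc j a n)
    show ?case
    proof (cases "a < \<theta>")
      case True
      have n: "k2 - n = Suc (k2 - Suc n)" using Suc.prems k by simp
      have "1 - chebyshev c1 (Suc j) a - chebyshev c2 (k2 - n) a \<le>
          measure_pmf.expectation D (\<lambda>x. 1 - chebyshev c1 j (a + x) - chebyshev c2 (k2 - Suc n) (a + x))"
        unfolding n using expectation_chebyshev_le[of c1 j a] expectation_chebyshev_le[of c2 "k2 - Suc n" a]
        by (simp add: Bochner_Integration.integral_diff)
      also have "\<dots> \<le> measure_pmf.expectation D (\<lambda>x. measure_pmf.prob (r (a + x) (Suc n)) (outputs_in G))"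
        using Suc.prems by (intro integral_mono Suc.IH integrable) auto
      finally show ?thesis by (simp add: prob_continue True)
    qed (auto intro!: stopped)
  }
qed

text \<open>The centres \<open>k1 * \<mu>\<close> and \<open>k2 * \<mu>\<close> cancel the squares
  at the empty sum and leave the usual Chebyshev tails for \<open>k1\<close> and \<open>k2\<close>
  samples.\<close>

lemma prob_output_ge:
  fixes k1 k2 :: nat
  assumes "real k1 * \<mu> < \<theta>" "\<theta> < real k2 * \<mu>"
    and "\<And>i. k1 < i \<Longrightarrow> i \<le> k2 \<Longrightarrow> \<theta> / real i \<in> G"
  shows "1 - k1 * v / (\<theta> - k1 * \<mu>)\<^sup>2 - k2 * v / (k2 * \<mu> - \<theta>)\<^sup>2
    \<le> measure_pmf.prob (r 0 0) (outputs_in G)"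
proof -
  have "real k1 * \<mu> < real k2 * \<mu>" using assms by linarith
  then have "k1 \<le> k2" using mean_pos by simp
  from prob_stops_between[OF assms(1,2) refl this assms(3), of 0 k1 0] show ?thesis
    by (simp add: chebyshev_def power2_commute)
qed

end

section \<open>The algorithm\<close>

text \<open>Corecursion from a transition function, since the sampling loop has no a priori bound on
  its length.\<close>

primcorec unfold_algorithm :: "('s \<Rightarrow> ('v, 's) action pmf) \<Rightarrow> 's \<Rightarrow> 'v algorithm" where
  "action (unfold_algorithm f s) = map_pmf (map_action (unfold_algorithm f)) (f s)"

text \<open>Ties are split evenly, so the two orientations of an edge always carry total weight
  2.\<close>

definition contribution :: "nat \<Rightarrow> nat \<Rightarrow> nat \<Rightarrow> real" where
  "contribution t a b = (if a < b then 2 else if a = b then 1 else 0) * real (min a t)"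

text \<open>A round has one state before each of its four queries; the first two fields hold the
  running sum and the number of finished rounds.\<close>

datatype 'v sampling =
    Start real nat
  | Source real nat 'v
  | Target real nat 'v 'v
  | SourceDegree real nat 'v nat

fun sampling_step :: "real \<Rightarrow> nat \<Rightarrow> 'v sampling \<Rightarrow> ('v, 'v sampling) action" where
  "sampling_step \<theta> t (Start a n) = (if \<theta> \<le> a then Output (\<theta> / n) else RandVert (Source a n))"
| "sampling_step \<theta> t (Source a n v) = RandNbr v (Target a n v)"
| "sampling_step \<theta> t (Target a n v u) = Degree v (SourceDegree a n u)"
| "sampling_step \<theta> t (SourceDegree a n u d) =
     Degree u (\<lambda>d'. Start (a + contribution t d d') (Suc n))"

definition sampler :: "real \<Rightarrow> nat \<Rightarrow> 'v sampling \<Rightarrow> 'v algorithm" where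
  "sampler \<theta> t = unfold_algorithm (\<lambda>s. return_pmf (sampling_step \<theta> t s))"

lemma action_sampler:
  "action (sampler \<theta> t s) = return_pmf (map_action (sampler \<theta> t) (sampling_step \<theta> t s))"
  by (simp add: sampler_def)

text \<open>The order on identifiers serves to name the two endpoints of an edge; \<open>t\<close>
  accumulates the smaller degrees.\<close>

primrec probe_edges :: "nat \<Rightarrow> nat \<Rightarrow> (nat \<Rightarrow> 'v::linorder algorithm) \<Rightarrow> 'v algorithm" where
  "probe_edges 0 t k = k t"
| "probe_edges (Suc s) t k =
     Algorithm (return_pmf (RandEdge (\<lambda>e.
     Algorithm (return_pmf (Degree (Min e) (\<lambda>d.
     Algorithm (return_pmf (Degree (Max e) (\<lambda>d'.
       probe_edges s (t + min d d') k)))))))))"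

text \<open>With \<open>32 / \<epsilon>\<close> probes, \<open>(1 - \<epsilon> / 8) ^ s\<close> is
  at most \<open>exp (- 4)\<close>; the threshold \<open>40 * t / \<epsilon>\<close> makes each
  Chebyshev tail at most \<open>1 / 20\<close>.\<close>

definition degree_estimator :: "real \<Rightarrow> 'v::linorder algorithm" where
  "degree_estimator \<epsilon> =
     probe_edges (nat \<lceil>32 / \<epsilon>\<rceil>) 0 (\<lambda>t. sampler (40 * real t / \<epsilon>) t (Start 0 0))"

text \<open>Up to 1 this follows from \<open>1 \<le> (1 + z) * (1 - z / 2)\<close> and
  \<open>1 + z \<le> exp z\<close>; beyond 1 from \<open>2 \<le> exp z\<close>. It converts
  exponential moments of \<open>Y\<close> into means of \<open>min Y t\<close>.\<close>

lemma exp_minus_le: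
  fixes z :: real
  assumes "0 \<le> z"
  shows "exp (- z) \<le> 1 - min z 1 / 2"
proof (cases "z \<le> 1")
  case True
  have "z * z \<le> z" using assms True by (simp add: mult_left_le)
  then have "1 \<le> (1 + z) * (1 - z / 2)" by (simp add: algebra_simps)
  also have "\<dots> \<le> exp z * (1 - z / 2)"
    using exp_ge_add_one_self[of z] True by (intro mult_right_mono) auto
  finally show ?thesis using True by (simp add: exp_minus field_simps)
next
  case False
  have "2 \<le> exp z" using exp_ge_add_one_self[of z] False by linarith
  then show ?thesis using False by (simp add: exp_minus field_simps)
qed

section \<open>Moments of the capped estimator\<close>

locale query_graph =
  fixes V :: "'v::linorder set" and E :: "'v set set"
  assumes graph: "simple_graph V E" and no_isolated: "no_isolated V E"
begin

lemma finite_V: "finite V" and V_nonempty: "V \<noteq> {}"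
  using graph by (auto simp: simple_graph_def)

lemma finite_E: "finite E"
proof (rule finite_subset)
  show "E \<subseteq> Pow V" using graph by (auto simp: simple_graph_def)
qed (use finite_V in simp)

lemma edgeD: "{x, y} \<in> E \<Longrightarrow> x \<in> V \<and> y \<in> V \<and> x \<noteq> y"
  using graph by (fastforce simp: simple_graph_def)

lemma finite_neighbors: "finite (neighbors E x)"
  using edgeD by (intro finite_subset[OF _ finite_V]) (auto simp: neighbors_def)

lemma neighbors_nonempty: "x \<in> V \<Longrightarrow> neighbors E x \<noteq> {}"
  using no_isolated by (auto simp: no_isolated_def)

lemma deg_pos: "x \<in> V \<Longrightarrow> 0 < deg E x"
  using finite_neighbors neighbors_nonempty by (auto simp: deg_def card_gt_0_iff)

lemma E_nonempty: "E \<noteq> {}"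
  using V_nonempty neighbors_nonempty by (auto simp: neighbors_def)

lemma card_E_pos: "0 < card E" and card_V_pos: "0 < card V"
  using finite_E E_nonempty finite_V V_nonempty by (auto simp: card_gt_0_iff)

lemma edge_Min_Max:
  assumes "e \<in> E"
  shows "e = {Min e, Max e}" "Min e < Max e" "Min e \<in> V" "Max e \<in> V"
proof -
  have "card e = 2" using assms graph by (simp add: simple_graph_def)
  then obtain x y where e: "e = {x, y}" "x \<noteq> y" by (auto simp: card_2_iff)
  with assms show "e = {Min e, Max e}" "Min e < Max e" "Min e \<in> V" "Max e \<in> V"
    using edgeD[of x y] by (auto simp: min_def max_def)
qed

text \<open>Weighted handshake identity: the ordered adjacent pairs split into the increasing and
  the decreasing orientation of every edge.\<close>

lemma sum_over_neighbors:
  fixes F :: "'v \<Rightarrow> 'v \<Rightarrow> real"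
  shows "(\<Sum>v\<in>V. \<Sum>u\<in>neighbors E v. F v u) = (\<Sum>e\<in>E. F (Min e) (Max e) + F (Max e) (Min e))"
proof -
  let ?A = "(\<lambda>e. (Min e, Max e)) ` E" and ?B = "(\<lambda>e. (Max e, Min e)) ` E"
  have inj: "inj_on (\<lambda>e. (Min e, Max e)) E" "inj_on (\<lambda>e. (Max e, Min e)) E"
    by (rule inj_onI, metis edge_Min_Max(1) prod.inject)+
  have "(\<Sum>v\<in>V. \<Sum>u\<in>neighbors E v. F v u) = (\<Sum>(v, u)\<in>Sigma V (neighbors E). F v u)"
    by (rule sum.Sigma) (auto simp: finite_V finite_neighbors)
  also have "Sigma V (neighbors E) = ?A \<union> ?B"
  proof (intro equalityI subsetI)
    fix z assume "z \<in> Sigma V (neighbors E)"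
    then obtain v u where z: "z = (v, u)" "{v, u} \<in> E" by (auto simp: neighbors_def)
    then have "v < u \<and> z = (Min {v, u}, Max {v, u}) \<or> u < v \<and> z = (Max {v, u}, Min {v, u})"
      using edgeD[of v u] by (auto simp: min_def max_def)
    then show "z \<in> ?A \<union> ?B" using z by blast
  next
    fix z assume "z \<in> ?A \<union> ?B"
    then show "z \<in> Sigma V (neighbors E)"
      using edge_Min_Max by (auto simp: neighbors_def insert_commute)
  qed
  also have "(\<Sum>(v, u)\<in>?A \<union> ?B. F v u) = (\<Sum>(v, u)\<in>?A. F v u) + (\<Sum>(v, u)\<in>?B. F v u)"
    using finite_E by (intro sum.union_disjoint) (auto dest!: edge_Min_Max(2))
  also have "(\<Sum>(v, u)\<in>?A. F v u) = (\<Sum>e\<in>E. F (Min e) (Max e))"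
    using inj by (subst sum.reindex) auto
  also have "(\<Sum>(v, u)\<in>?B. F v u) = (\<Sum>e\<in>E. F (Max e) (Min e))"
    using inj by (subst sum.reindex) auto
  finally show ?thesis by (simp add: sum.distrib)
qed

definition min_degree :: "'v set \<Rightarrow> nat" where
  "min_degree e = min (deg E (Min e)) (deg E (Max e))"

lemma min_degree_pos: "e \<in> E \<Longrightarrow> 0 < min_degree e"
  using edge_Min_Max deg_pos by (auto simp: min_degree_def)

text \<open>Expectation over \<open>RandEdge\<close>, as a finite sum so that linearity and
  monotonicity need no integrability.\<close>

definition edge_mean :: "('v set \<Rightarrow> real) \<Rightarrow> real" where
  "edge_mean F = (\<Sum>e\<in>E. F e) / card E"

lemma edge_mean_mono: "(\<And>e. e \<in> E \<Longrightarrow> F e \<le> G e) \<Longrightarrow> edge_mean F \<le> edge_mean G"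
  unfolding edge_mean_def by (intro divide_right_mono sum_mono) auto

lemma edge_mean_simps [simp]:
  "edge_mean (\<lambda>e. c) = c"
  "edge_mean (\<lambda>e. F e + G e) = edge_mean F + edge_mean G"
  "edge_mean (\<lambda>e. F e - G e) = edge_mean F - edge_mean G"
  "edge_mean (\<lambda>e. c * F e) = c * edge_mean F"
  "edge_mean (\<lambda>e. F e / c) = edge_mean F / c"
  using card_E_pos unfolding edge_mean_def
  by (simp_all add: sum.distrib sum_subtractf add_divide_distrib diff_divide_distrib
      sum_distrib_left[symmetric] sum_divide_distrib[symmetric])

abbreviation d :: real where "d \<equiv> avg_degree V E"

lemma d_pos: "0 < d"
  using card_E_pos card_V_pos by (simp add: avg_degree_def)

lemma sum_deg: "(\<Sum>v\<in>V. real (deg E v)) = 2 * real (card E)"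
  using sum_over_neighbors[of "\<lambda>_ _. 1"] by (simp add: deg_def)

definition mean_min_degree :: real where
  "mean_min_degree = edge_mean (\<lambda>e. real (min_degree e))"

definition capped_mean :: "nat \<Rightarrow> real" where
  "capped_mean t = edge_mean (\<lambda>e. real (min (min_degree e) t))"

text \<open>The factor by which the cap shrinks the mean of the estimator.\<close>

definition kept_fraction :: "nat \<Rightarrow> real" where
  "kept_fraction t = edge_mean (\<lambda>e. real (min (min_degree e) t) / real (min_degree e))"

lemma mean_min_degree_pos: "0 < mean_min_degree"
proof -
  have "1 = edge_mean (\<lambda>e. 1)" by simp
  also have "\<dots> \<le> mean_min_degree" unfolding mean_min_degree_def
    using min_degree_pos by (intro edge_mean_mono) (simp add: Suc_le_eq)
  finally show ?thesis by simp
qed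

lemma mean_min_degree_le: "mean_min_degree \<le> 3 * sqrt (card E)"
proof -
  text \<open>If \<open>min a b > c\<close> then \<open>min a b = a b / max a b \<le> a b / c\<close>, and the sum of \<open>deg v deg u\<close> over all
    pairs of vertices is \<open>4 m\<^sup>2\<close>.\<close>
  define m where "m = real (card E)"
  define c where "c = sqrt m"
  have m: "0 < m" and c: "0 < c" and cc: "c * c = m"
    using card_E_pos by (auto simp: m_def c_def)
  have min_le: "real (min a b) \<le> c + real a * real b / c" for a b :: nat
  proof (cases "real (min a b) \<le> c")
    case False
    then have "c * real (min a b) \<le> real (max a b) * real (min a b)"
      by (intro mult_right_mono) auto
    also have "\<dots> = real a * real b" by (cases "a \<le> b") auto
    finally show ?thesis using c by (simp add: field_simps add_increasing)
  qed (use c in \<open>simp add: add_increasing2\<close>)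
  have "2 * (\<Sum>e\<in>E. real (min_degree e)) = (\<Sum>v\<in>V. \<Sum>u\<in>neighbors E v. real (min (deg E v) (deg E u)))"
    by (subst sum_over_neighbors) (simp add: min_degree_def min.commute sum_distrib_left)
  also have "\<dots> \<le> (\<Sum>v\<in>V. \<Sum>u\<in>neighbors E v. c + real (deg E v) * real (deg E u) / c)"
    by (intro sum_mono min_le)
  also have "\<dots> = 2 * m * c + (\<Sum>v\<in>V. \<Sum>u\<in>neighbors E v. real (deg E v) * real (deg E u) / c)"
    using sum_deg by (simp add: sum.distrib deg_def sum_distrib_right[symmetric] m_def)
  also have "(\<Sum>v\<in>V. \<Sum>u\<in>neighbors E v. real (deg E v) * real (deg E u) / c)
      \<le> (\<Sum>v\<in>V. \<Sum>u\<in>V. real (deg E v) * real (deg E u) / c)"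
    using c edgeD by (intro sum_mono sum_mono2 finite_V) (auto simp: neighbors_def)
  also have "\<dots> = (2 * m) * (2 * m) / c"
    unfolding sum_divide_distrib[symmetric] sum_product[symmetric] sum_deg m_def by simp
  also have "\<dots> = 4 * m * c" using c cc by (simp add: field_simps)
  finally have "(\<Sum>e\<in>E. real (min_degree e)) \<le> 3 * m * c" by (simp add: mult_ac)
  then show ?thesis using m
    by (simp add: mean_min_degree_def edge_mean_def field_simps m_def c_def)
qed

lemma capped_mean_le: "capped_mean t \<le> mean_min_degree"
  unfolding capped_mean_def mean_min_degree_def by (intro edge_mean_mono) simp

lemma kept_fraction_ge: 
  assumes "0 < t"
  shows "t / (t + mean_min_degree) \<le> kept_fraction t"
proof -
  text \<open>Jensen's inequality for \<open>1 / z\<close>, through the tangent at \<open>z = w\<close>.\<close>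
  define w where "w = t + mean_min_degree"
  have w: "0 < w" using mean_min_degree_pos by (simp add: w_def)
  have pointwise: "t * (2 / w - (real t + real y) / w\<^sup>2) \<le> real (min y t) / real y" if "0 < y" for y :: nat
  proof -
    define z where "z = real t + real y"
    have z: "0 < z" using assms by (simp add: z_def)
    have "0 \<le> (w - z)\<^sup>2 / (z * w\<^sup>2)" using z by simp
    also have "\<dots> = 1 / z - (2 / w - z / w\<^sup>2)"
      using z w by (simp add: field_simps power2_eq_square)
    finally have "t * (2 / w - z / w\<^sup>2) \<le> t * (1 / z)"
      by (intro mult_left_mono) auto
    \<comment> \<open>The right side is 1 or \<open>t / y\<close>, and both are at least
      \<open>t / (t + y)\<close>.\<close>
    also have "\<dots> \<le> real (min y t) / real y"
      using that assms by (cases "y \<le> t") (auto simp: z_def field_simps min_def)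
    finally show ?thesis by (simp add: z_def)
  qed
  have "t / w = t * (2 / w - (t + mean_min_degree) / w\<^sup>2)"
    using w unfolding w_def[symmetric] by (simp add: field_simps power2_eq_square)
  also have "\<dots> = edge_mean (\<lambda>e. t * (2 / w - (t + real (min_degree e)) / w\<^sup>2))"
    by (simp add: mean_min_degree_def)
  also have "\<dots> \<le> kept_fraction t"
    unfolding kept_fraction_def using min_degree_pos by (intro edge_mean_mono pointwise) auto
  finally show ?thesis by (simp add: w_def)
qed

lemma kept_fraction_pos: "0 < t \<Longrightarrow> 0 < kept_fraction t"
  by (rule less_le_trans[OF _ kept_fraction_ge]) (use mean_min_degree_pos in auto)

lemma kept_fraction_le_1: "kept_fraction t \<le> 1"
proof -
  have "kept_fraction t \<le> edge_mean (\<lambda>e. 1)" unfolding kept_fraction_def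
    using min_degree_pos by (intro edge_mean_mono) simp
  then show ?thesis by simp
qed

text \<open>Pointwise, an edge with \<open>min_degree e \<le> t\<close> is kept in full, and any
  other makes the left side zero. This controls the bias for good \<open>t\<close>.\<close>

lemma kept_fraction_ge_capped_mean:
  assumes "0 < t"
  shows "1 - capped_mean t / t \<le> kept_fraction t"
proof -
  have "1 - capped_mean t / t = edge_mean (\<lambda>e. 1 - real (min (min_degree e) t) / t)"
    by (simp add: capped_mean_def)
  also have "\<dots> \<le> kept_fraction t" unfolding kept_fraction_def
    using assms min_degree_pos by (intro edge_mean_mono) (auto simp: min_def)
  finally show ?thesis .
qed

section \<open>Law of one capped sample\<close>

definition sample_distribution :: "nat \<Rightarrow> real pmf" where
  "sample_distribution t = bind_pmf (pmf_of_set V) (\<lambda>v.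
     map_pmf (\<lambda>u. contribution t (deg E v) (deg E u)) (pmf_of_set (neighbors E v)))"

lemma set_sample_distribution:
  "set_pmf (sample_distribution t) =
     (\<Union>v\<in>V. (\<lambda>u. contribution t (deg E v) (deg E u)) ` neighbors E v)"
  using finite_V V_nonempty finite_neighbors neighbors_nonempty
  by (auto simp: sample_distribution_def set_bind_pmf)

text \<open>The pair \<open>(v, u)\<close> is drawn with probability
  \<open>1 / (card V * deg E v)\<close>; the pairs are then regrouped by edges.\<close>

lemma expectation_sample_distribution:
  "measure_pmf.expectation (sample_distribution t) h =
     (\<Sum>e\<in>E. h (contribution t (deg E (Min e)) (deg E (Max e))) / deg E (Min e)
       + h (contribution t (deg E (Max e)) (deg E (Min e))) / deg E (Max e)) / card V"
    (is "_ = ?rhs")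
  for h :: "real \<Rightarrow> real"
proof -
  have "measure_pmf.expectation (sample_distribution t) h =
      (\<Sum>v\<in>V. measure_pmf.expectation (map_pmf (\<lambda>u. contribution t (deg E v) (deg E u))
        (pmf_of_set (neighbors E v))) h /\<^sub>R card V)"
    unfolding sample_distribution_def
    using finite_V V_nonempty finite_neighbors neighbors_nonempty
    by (intro pmf_expectation_bind_pmf_of_set) auto
  also have "\<dots> = (\<Sum>v\<in>V. (\<Sum>u\<in>neighbors E v. h (contribution t (deg E v) (deg E u)) / deg E v)) / card V"
    using finite_neighbors neighbors_nonempty
    by (simp add: integral_pmf_of_set sum_divide_distrib deg_def divide_inverse mult.commute
          sum_distrib_left)
  also have "\<dots> = ?rhs" by (subst sum_over_neighbors) simp
  finally show ?thesis .
qed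

text \<open>The endpoint of smaller degree carries all the weight, or both carry half at a tie, so
  each edge gives \<open>2 * min Y t / Y\<close>.\<close>

lemma sample_mean:
  "measure_pmf.expectation (sample_distribution t) (\<lambda>x. x) = d * kept_fraction t"
proof -
  have "contribution t a b / a + contribution t b a / b = 2 * (real (min (min a b) t) / real (min a b))"
    if "0 < a" "0 < b" for a b
    using that by (cases a b rule: linorder_cases) (auto simp: contribution_def min_def)
  then have "measure_pmf.expectation (sample_distribution t) (\<lambda>x. x) =
      (\<Sum>e\<in>E. 2 * (real (min (min_degree e) t) / real (min_degree e))) / card V"
    unfolding expectation_sample_distribution
    using deg_pos edge_Min_Max by (simp add: min_degree_def)
  also have "\<dots> = d * kept_fraction t"
    unfolding sum_distrib_left[symmetric]
    using card_E_pos by (simp add: kept_fraction_def edge_mean_def avg_degree_def)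
  finally show ?thesis .
qed

text \<open>One factor \<open>min a t \<le> a\<close> absorbs the division by the source degree; the
  4 is the square of the weight 2.\<close>

lemma sample_second_moment:
  "measure_pmf.expectation (sample_distribution t) (\<lambda>x. x\<^sup>2) \<le> 2 * d * capped_mean t"
proof -
  have *: "(contribution t a b)\<^sup>2 / a + (contribution t b a)\<^sup>2 / b \<le> 4 * real (min (min a b) t)"
    if "0 < a" "0 < b" for a b
  proof -
    have sq: "(real (min x t))\<^sup>2 / x \<le> real (min x t)" if "0 < x" for x
      using that by (simp add: power2_eq_square divide_le_eq mult_right_mono mult.commute)
    show ?thesis using sq[of a] sq[of b] that
      by (cases a b rule: linorder_cases) (simp_all add: contribution_def power_mult_distrib)
  qed
  have "measure_pmf.expectation (sample_distribution t) (\<lambda>x. x\<^sup>2) \<le>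
      (\<Sum>e\<in>E. 4 * real (min (min_degree e) t)) / card V"
    unfolding expectation_sample_distribution min_degree_def
    using deg_pos edge_Min_Max by (intro divide_right_mono sum_mono *) auto
  also have "\<dots> = 2 * d * capped_mean t"
    using card_E_pos by (simp add: capped_mean_def edge_mean_def avg_degree_def sum_distrib_left[symmetric])
  finally show ?thesis .
qed

section \<open>Runs of the algorithm on a graph\<close>

lemma run_sampler_stop:
  "\<theta> \<le> a \<Longrightarrow> run V E (sampler \<theta> t (Start a n)) = return_spmf (\<theta> / n, 0)"
  by (subst run.simps) (simp add: action_sampler)

lemma run_sampler_continue:
  assumes "a < \<theta>"
  shows "run V E (sampler \<theta> t (Start a n)) = bind_pmf (sample_distribution t)
    (\<lambda>x. map_spmf (apsnd ((+) 4)) (run V E (sampler \<theta> t (Start (a + x) (Suc n)))))"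
proof -
  have source_degree: "run V E (sampler \<theta> t (SourceDegree a n u k)) =
      map_spmf (apsnd Suc) (run V E (sampler \<theta> t (Start (a + contribution t k (deg E u)) (Suc n))))"
    if "u \<in> V" for u k
    using that by (subst run.simps) (simp add: action_sampler)
  have target: "run V E (sampler \<theta> t (Target a n v u)) =
      map_spmf (apsnd Suc) (run V E (sampler \<theta> t (SourceDegree a n u (deg E v))))"
    if "v \<in> V" for u v
    using that by (subst run.simps) (simp add: action_sampler)
  have source: "run V E (sampler \<theta> t (Source a n v)) = bind_pmf (pmf_of_set (neighbors E v))
      (\<lambda>u. map_spmf (apsnd Suc) (run V E (sampler \<theta> t (Target a n v u))))"
    if "v \<in> V" for v
    using that finite_neighbors neighbors_nonempty
    by (subst run.simps) (simp add: action_sampler flip: spmf_of_pmf_pmf_of_set)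
  have start: "run V E (sampler \<theta> t (Start a n)) = bind_pmf (pmf_of_set V)
      (\<lambda>v. map_spmf (apsnd Suc) (run V E (sampler \<theta> t (Source a n v))))"
    using assms finite_V V_nonempty
    by (subst run.simps) (simp add: action_sampler flip: spmf_of_pmf_pmf_of_set)
  show ?thesis
    unfolding start sample_distribution_def bind_assoc_pmf bind_map_pmf
  proof (intro bind_pmf_cong refl)
    fix v assume "v \<in> set_pmf (pmf_of_set V)"
    then have v: "v \<in> V" using finite_V V_nonempty by simp
    show "map_spmf (apsnd Suc) (run V E (sampler \<theta> t (Source a n v))) =
      bind_pmf (pmf_of_set (neighbors E v)) (\<lambda>u. map_spmf (apsnd ((+) 4))
        (run V E (sampler \<theta> t (Start (a + contribution t (deg E v) (deg E u)) (Suc n)))))"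
      unfolding source[OF v] map_bind_pmf
    proof (intro bind_pmf_cong refl)
      fix u assume "u \<in> set_pmf (pmf_of_set (neighbors E v))"
      then have u: "u \<in> V" using finite_neighbors neighbors_nonempty[OF v] edgeD by (auto simp: neighbors_def)
      have *: "apsnd Suc \<circ> (apsnd Suc \<circ> (apsnd Suc \<circ> apsnd Suc)) = apsnd ((+) 4)"
        by (auto simp: fun_eq_iff)
      show "map_spmf (apsnd Suc) (map_spmf (apsnd Suc) (run V E (sampler \<theta> t (Target a n v u)))) =
        map_spmf (apsnd ((+) 4)) (run V E (sampler \<theta> t (Start (a + contribution t (deg E v) (deg E u)) (Suc n))))"
        by (simp add: target[OF v] source_degree[OF u] spmf.map_comp *)
    qed
  qed
qed

lemma run_probe_edges:
  "run V E (probe_edges (Suc s) t k) = bind_pmf (pmf_of_set E)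
     (\<lambda>e. map_spmf (apsnd ((+) 3)) (run V E (probe_edges s (t + min_degree e) k)))"
proof -
  have "run V E (probe_edges (Suc s) t k) = bind_pmf (pmf_of_set E) (\<lambda>e. map_spmf (apsnd Suc)
     (run V E (Algorithm (return_pmf (Degree (Min e) (\<lambda>d.
     Algorithm (return_pmf (Degree (Max e) (\<lambda>d'. probe_edges s (t + min d d') k)))))))))"
    using finite_E E_nonempty
    by (subst run.simps) (simp flip: spmf_of_pmf_pmf_of_set)
  also have "\<dots> = bind_pmf (pmf_of_set E)
     (\<lambda>e. map_spmf (apsnd ((+) 3)) (run V E (probe_edges s (t + min_degree e) k)))"
  proof (intro bind_pmf_cong refl)
    fix e assume "e \<in> set_pmf (pmf_of_set E)"
    then have e: "e \<in> E" using finite_E E_nonempty by simp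
    have *: "apsnd Suc \<circ> (apsnd Suc \<circ> apsnd Suc) = apsnd ((+) 3)"
      by (auto simp: fun_eq_iff)
    show "map_spmf (apsnd Suc) (run V E (Algorithm (return_pmf (Degree (Min e) (\<lambda>d.
        Algorithm (return_pmf (Degree (Max e) (\<lambda>d'. probe_edges s (t + min d d') k)))))))) =
      map_spmf (apsnd ((+) 3)) (run V E (probe_edges s (t + min_degree e) k))"
      using edge_Min_Max[OF e]
      by (subst run.simps, simp, subst run.simps, simp add: min_degree_def spmf.map_comp * comp_assoc)
  qed
  finally show ?thesis .
qed

lemma expectation_edge: "measure_pmf.expectation (pmf_of_set E) F = edge_mean F"
  for F :: "'v set \<Rightarrow> real"
  using finite_E E_nonempty by (simp add: integral_pmf_of_set edge_mean_def)

section \<open>The sampling phase for a fixed cap \<open>t\<close>\<close>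

lemma stopping_rule_sampler:
  assumes "0 < t"
  shows "stopping_rule (sample_distribution t) (2 * t) (d * kept_fraction t) (2 * d * capped_mean t)
    \<theta> (\<lambda>a n. run V E (sampler \<theta> t (Start a n)))"
proof
  show "finite (set_pmf (sample_distribution t))"
    unfolding set_sample_distribution using finite_V finite_neighbors by auto
  have "0 \<le> contribution t a b" "contribution t a b \<le> 2 * t" for a b
    by (auto simp: contribution_def)
  then show "x \<in> set_pmf (sample_distribution t) \<Longrightarrow> 0 \<le> x"
    and "x \<in> set_pmf (sample_distribution t) \<Longrightarrow> x \<le> 2 * t" for x
    unfolding set_sample_distribution by auto
  show "measure_pmf.expectation (sample_distribution t) (\<lambda>x. x) = d * kept_fraction t"
    by (rule sample_mean)
  show "0 < d * kept_fraction t"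
    using d_pos kept_fraction_pos[OF assms] by simp
  show "measure_pmf.expectation (sample_distribution t) power2 \<le> 2 * d * capped_mean t"
    by (rule sample_second_moment)
qed (simp_all add: run_sampler_stop run_sampler_continue)

text \<open>Every \<open>t\<close> must be covered, since unlucky ones enter the expected cost too.
  A small \<open>t\<close> lowers the sample mean, but \<open>t / kept_fraction t\<close> is at most
  \<open>t + mean_min_degree\<close>.\<close>

lemma capped_cost_sampler_le:
  assumes "0 < \<epsilon>" "\<epsilon> < 1"
  shows "capped_cost k (run V E (sampler (40 * real t / \<epsilon>) t (Start 0 0))) \<le>
    ennreal (168 / (\<epsilon> * d) * (t + mean_min_degree))"
proof (cases "t = 0")
  case True
  \<comment> \<open>The threshold is 0, so the sampler outputs without any query.\<close>
  then show ?thesis by (simp add: run_sampler_stop capped_cost_def)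
next
  case False
  let ?\<theta> = "40 * real t / \<epsilon>" and ?q = "kept_fraction t"
  from False have t: "0 < t" by simp
  interpret stopping_rule "sample_distribution t" "2 * t" "d * ?q" "2 * d * capped_mean t"
    ?\<theta> "\<lambda>a n. run V E (sampler ?\<theta> t (Start a n))"
    by (rule stopping_rule_sampler[OF t])
  have q: "0 < ?q" "t / ?q \<le> t + mean_min_degree"
    using kept_fraction_pos[OF t] kept_fraction_ge[OF t] t mean_min_degree_pos
    by (auto simp: field_simps)
  have "capped_cost k (run V E (sampler ?\<theta> t (Start 0 0))) \<le> ennreal (4 * (?\<theta> + 2 * t - 0) / (d * ?q))"
    using assms by (intro capped_cost_le) simp
  also have "\<dots> \<le> ennreal (168 / (\<epsilon> * d) * (t + mean_min_degree))"
  proof (intro ennreal_leI)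
    have "t * \<epsilon> \<le> t" using assms by (simp add: mult_left_le)
    then have "?\<theta> + 2 * t \<le> 42 * t / \<epsilon>" using assms by (simp add: field_simps)
    then have "4 * (?\<theta> + 2 * t - 0) / (d * ?q) \<le> 4 * (42 * t / \<epsilon>) / (d * ?q)"
      using q d_pos by (intro divide_right_mono) auto
    also have "\<dots> = 168 / (\<epsilon> * d) * (t / ?q)" by simp
    also have "\<dots> \<le> 168 / (\<epsilon> * d) * (t + mean_min_degree)"
      using q assms d_pos by (intro mult_left_mono) auto
    finally show "4 * (?\<theta> + 2 * t - 0) / (d * ?q) \<le> 168 / (\<epsilon> * d) * (t + mean_min_degree)" .
  qed
  finally show ?thesis .
qed

text \<open>The hypothesis \<open>good\<close> limits the relative bias to
  \<open>\<epsilon> / 4\<close> and the second moment to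
  \<open>d * \<epsilon>\<^sup>2 * \<theta> / 80\<close>, so both Chebyshev tails are small.\<close>

lemma prob_sampler_ge:
  assumes \<epsilon>: "0 < \<epsilon>" "\<epsilon> < 1" and good: "capped_mean t < \<epsilon> * t / 4"
  shows "9 / 10 \<le> measure_pmf.prob (run V E (sampler (40 * real t / \<epsilon>) t (Start 0 0)))
    (outputs_in {(1 - \<epsilon>) * d .. (1 + \<epsilon>) * d})"
proof -
  have t: "0 < t"
    using good by (cases "t = 0") (auto simp: capped_mean_def)
  define \<theta> where "\<theta> = 40 * real t / \<epsilon>"
  define \<mu> where "\<mu> = d * kept_fraction t"
  define v where "v = 2 * d * capped_mean t"
  interpret stopping_rule "sample_distribution t" "2 * t" \<mu> v \<theta>
    "\<lambda>a n. run V E (sampler \<theta> t (Start a n))"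
    unfolding \<mu>_def v_def by (rule stopping_rule_sampler[OF t])
  have \<theta>: "0 < \<theta>" and t_eq: "t = \<theta> * \<epsilon> / 40" using \<epsilon> t by (auto simp: \<theta>_def)
  \<comment> \<open>The second bound is \<open>mean_le\<close> with \<open>B = 2 * t\<close>; it
    later absorbs the rounding in \<open>k2\<close>.\<close>
  have \<mu>_le: "\<mu> \<le> d" "\<mu> \<le> \<theta> * \<epsilon> / 20"
    using mult_left_mono[OF kept_fraction_le_1[of t], of d] d_pos mean_le t_eq
    by (auto simp: \<mu>_def mult.commute)
  have "1 - \<epsilon> / 4 \<le> 1 - capped_mean t / t"
    using good t by (simp add: field_simps)
  also have "\<dots> \<le> kept_fraction t" by (rule kept_fraction_ge_capped_mean[OF t])
  finally have \<mu>_ge: "d * (1 - \<epsilon> / 4) \<le> \<mu>"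
    unfolding \<mu>_def using d_pos by (intro mult_left_mono) auto
  have v_le: "v \<le> d * \<epsilon>\<^sup>2 * \<theta> / 80"
  proof -
    have "v \<le> 2 * d * (\<epsilon> * t / 4)"
      unfolding v_def using d_pos good by (intro mult_left_mono) auto
    then show ?thesis by (simp add: t_eq power2_eq_square field_simps)
  qed
  \<comment> \<open>Every count \<open>i\<close> with \<open>k1 < i\<close> and
    \<open>i \<le> k2\<close> gives an output \<open>\<theta> / i\<close> in the accuracy
    window.\<close>
  define k1 where "k1 = nat \<lfloor>\<theta> / ((1 + \<epsilon>) * d)\<rfloor>"
  define k2 where "k2 = nat \<lfloor>\<theta> / ((1 - \<epsilon>) * d)\<rfloor>"
  have k1: "real k1 \<le> \<theta> / ((1 + \<epsilon>) * d)" "\<theta> / ((1 + \<epsilon>) * d) < real k1 + 1"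
    using \<theta> \<epsilon> d_pos by (auto simp: k1_def)
  have k2: "real k2 \<le> \<theta> / ((1 - \<epsilon>) * d)" "\<theta> / ((1 - \<epsilon>) * d) < real k2 + 1"
    using \<theta> \<epsilon> d_pos by (auto simp: k2_def)

  have lower: "\<theta> * \<epsilon> / 2 \<le> \<theta> - k1 * \<mu>"
  proof -
    have "k1 * \<mu> \<le> \<theta> / ((1 + \<epsilon>) * d) * d"
      using k1 \<mu>_le mean_pos \<theta> \<epsilon> d_pos by (intro mult_mono) auto
    also have "\<dots> = \<theta> / (1 + \<epsilon>)" using d_pos by simp
    also have "\<dots> \<le> \<theta> * (1 - \<epsilon> / 2)"
    proof -
      have "1 \<le> (1 - \<epsilon> / 2) * (1 + \<epsilon>)" using \<epsilon> mult_left_le[of \<epsilon> \<epsilon>] by (simp add: algebra_simps)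
      then have "\<theta> * 1 \<le> \<theta> * ((1 - \<epsilon> / 2) * (1 + \<epsilon>))" using \<theta> by (intro mult_left_mono) auto
      then show ?thesis using \<epsilon> by (simp add: divide_le_eq mult_ac)
    qed
    finally show ?thesis by (simp add: algebra_simps)
  qed
  \<comment> \<open>The gap is kept proportional to \<open>1 / (1 - \<epsilon>)\<close>, which
    outweighs the growth of \<open>k2\<close> as \<epsilon> approaches 1.\<close>
  have upper: "\<theta> * \<epsilon> / (2 * (1 - \<epsilon>)) \<le> k2 * \<mu> - \<theta>"
  proof -
    have "\<theta> * (1 - \<epsilon> / 4) / (1 - \<epsilon>) = \<theta> / ((1 - \<epsilon>) * d) * (d * (1 - \<epsilon> / 4))"
      using d_pos by simp
    also have "\<dots> \<le> \<theta> / ((1 - \<epsilon>) * d) * \<mu>"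
      using \<mu>_ge \<theta> \<epsilon> d_pos by (intro mult_left_mono) auto
    also have "\<dots> \<le> (real k2 + 1) * \<mu>"
      using k2 mean_pos by (intro mult_right_mono) auto
    also have "\<dots> \<le> k2 * \<mu> + \<theta> * \<epsilon> / 20" using \<mu>_le by (simp add: algebra_simps)
    finally have *: "\<theta> * (1 - \<epsilon> / 4) / (1 - \<epsilon>) - \<theta> - \<theta> * \<epsilon> / 20 \<le> k2 * \<mu> - \<theta>" by simp
    define X where "X = \<theta> * \<epsilon> / (1 - \<epsilon>)"
    define Y where "Y = \<theta> * \<epsilon>"
    have "\<theta> * (1 - \<epsilon> / 4) / (1 - \<epsilon>) - \<theta> = 3 / 4 * X"
      using \<epsilon> by (simp add: X_def field_simps)
    from *[unfolded this, folded Y_def] have "3 / 4 * X - Y / 20 \<le> k2 * \<mu> - \<theta>" .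
    moreover have "Y \<le> X" "0 < Y"
      using \<theta> \<epsilon> by (auto simp: X_def Y_def le_divide_eq mult_left_le)
    ultimately have "X / 2 \<le> k2 * \<mu> - \<theta>" by linarith
    then show ?thesis by (simp add: X_def mult.commute)
  qed
  have lower_pos: "0 < \<theta> * \<epsilon> / 2" and upper_pos: "0 < \<theta> * \<epsilon> / (2 * (1 - \<epsilon>))"
    using \<theta> \<epsilon> by auto

  have "k1 * v / (\<theta> - k1 * \<mu>)\<^sup>2 \<le> (\<epsilon>\<^sup>2 * \<theta>\<^sup>2 / 80) / (\<theta> * \<epsilon> / 2)\<^sup>2"
  proof (intro frac_le power_mono lower)
    have "k1 * v \<le> \<theta> / ((1 + \<epsilon>) * d) * (d * \<epsilon>\<^sup>2 * \<theta> / 80)"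
      using k1 v_le v_nonneg \<theta> \<epsilon> d_pos by (intro mult_mono) auto
    also have "\<dots> = (\<epsilon>\<^sup>2 * \<theta>\<^sup>2 / 80) / (1 + \<epsilon>)"
      using d_pos \<epsilon> by (simp add: power2_eq_square mult_ac)
    also have "\<dots> \<le> (\<epsilon>\<^sup>2 * \<theta>\<^sup>2 / 80) / 1" using \<epsilon> by (intro divide_left_mono) auto
    finally show "k1 * v \<le> \<epsilon>\<^sup>2 * \<theta>\<^sup>2 / 80" by simp
  qed (use \<theta> \<epsilon> in auto)
  also have "\<dots> = 1 / 20" using \<theta> \<epsilon> by (simp add: power2_eq_square)
  finally have fail1: "k1 * v / (\<theta> - k1 * \<mu>)\<^sup>2 \<le> 1 / 20" .

  have "k2 * v / (k2 * \<mu> - \<theta>)\<^sup>2 \<le> (\<epsilon>\<^sup>2 * \<theta>\<^sup>2 / (80 * (1 - \<epsilon>))) / (\<theta> * \<epsilon> / (2 * (1 - \<epsilon>)))\<^sup>2"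
  proof (intro frac_le power_mono upper)
    have "k2 * v \<le> \<theta> / ((1 - \<epsilon>) * d) * (d * \<epsilon>\<^sup>2 * \<theta> / 80)"
      using k2 v_le v_nonneg \<theta> \<epsilon> d_pos by (intro mult_mono) auto
    also have "\<dots> = \<epsilon>\<^sup>2 * \<theta>\<^sup>2 / (80 * (1 - \<epsilon>))"
      using d_pos \<epsilon> by (simp add: power2_eq_square mult_ac)
    finally show "k2 * v \<le> \<epsilon>\<^sup>2 * \<theta>\<^sup>2 / (80 * (1 - \<epsilon>))" .
  qed (use \<theta> \<epsilon> in auto)
  also have "\<dots> = (1 - \<epsilon>) / 20" using \<theta> \<epsilon> by (simp add: power2_eq_square field_simps)
  finally have fail2: "k2 * v / (k2 * \<mu> - \<theta>)\<^sup>2 \<le> 1 / 20" using \<epsilon> by simp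

  have "1 - k1 * v / (\<theta> - k1 * \<mu>)\<^sup>2 - k2 * v / (k2 * \<mu> - \<theta>)\<^sup>2
    \<le> measure_pmf.prob (run V E (sampler \<theta> t (Start 0 0))) (outputs_in {(1 - \<epsilon>) * d .. (1 + \<epsilon>) * d})"
  proof (rule prob_output_ge)
    fix i :: nat assume i: "k1 < i" "i \<le> k2"
    have "\<theta> / ((1 + \<epsilon>) * d) < i" "i \<le> \<theta> / ((1 - \<epsilon>) * d)" using k1 k2 i by linarith+
    then have "\<theta> < i * ((1 + \<epsilon>) * d)" "i * ((1 - \<epsilon>) * d) \<le> \<theta>"
      using \<epsilon> d_pos by (simp_all only: pos_divide_less_eq pos_le_divide_eq mult_pos_pos)
    then show "\<theta> / real i \<in> {(1 - \<epsilon>) * d .. (1 + \<epsilon>) * d}"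
      using i by (simp add: divide_le_eq le_divide_eq mult.commute)
  qed (use lower lower_pos upper upper_pos in linarith)+
  with fail1 fail2 show ?thesis by (simp add: \<theta>_def)
qed

text \<open>The bound for the continuation is affine in \<open>t\<close>, so averaging over an edge
  adds \<open>c * mean_min_degree\<close> for each probe, besides its three queries.\<close>

lemma capped_cost_probe_edges_le:
  assumes K: "\<And>k t. capped_cost k (run V E (K t)) \<le> ennreal (c * (t + mean_min_degree))"
    and c: "0 \<le> c"
  shows "capped_cost k (run V E (probe_edges s t K)) \<le>
    ennreal (3 * real s + c * (t + s * mean_min_degree + mean_min_degree))"
proof (induction s arbitrary: k t)
  case 0
  then show ?case using K[of k t] by simp
next
  case (Suc s)
  let ?R = mean_min_degree
  let ?F = "\<lambda>e. 3 + (3 * real s + c * (t + real (min_degree e) + s * ?R + ?R))"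
  have nonneg: "0 \<le> 3 * real s + c * (t + real (min_degree e) + s * ?R + ?R)" for e
    using c mean_min_degree_pos by simp
  have "capped_cost k (run V E (probe_edges (Suc s) t K)) \<le> (\<integral>\<^sup>+ e. ennreal (?F e) \<partial>pmf_of_set E)"
    unfolding run_probe_edges capped_cost_bind
  proof (intro nn_integral_mono)
    fix e
    have "capped_cost k (map_spmf (apsnd ((+) 3)) (run V E (probe_edges s (t + min_degree e) K))) \<le>
        of_nat 3 + capped_cost (k - 3) (run V E (probe_edges s (t + min_degree e) K))"
      by (rule capped_cost_add_queries)
    also have "\<dots> \<le> of_nat 3 + ennreal (3 * real s + c * (real (t + min_degree e) + s * ?R + ?R))"
      by (intro add_left_mono Suc.IH)
    also have "\<dots> = ennreal (?F e)" using nonneg[of e] by (subst ennreal_plus) auto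
    finally show "capped_cost k (map_spmf (apsnd ((+) 3)) (run V E (probe_edges s (t + min_degree e) K)))
      \<le> ennreal (?F e)" .
  qed
  also have "\<dots> = ennreal (measure_pmf.expectation (pmf_of_set E) ?F)"
  proof (intro nn_integral_eq_integral integrable_measure_pmf_finite)
    show "AE e in measure_pmf (pmf_of_set E). 0 \<le> ?F e"
      using nonneg by (intro AE_pmfI) (auto intro: add_nonneg_nonneg)
  qed (use finite_E E_nonempty in simp)
  also have "measure_pmf.expectation (pmf_of_set E) ?F =
      3 * real (Suc s) + c * (t + Suc s * ?R + ?R)"
    unfolding expectation_edge by (simp add: algebra_simps flip: mean_min_degree_def)
  finally show ?case .
qed

text \<open>Markov's inequality for \<open>exp (- t / \<tau>)\<close>, with \<open>t\<close> the final sum.\<close>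

lemma prob_probe_edges_ge:
  fixes p :: real and \<tau> \<rho> :: real
  assumes K: "\<And>t. \<tau> < real t \<Longrightarrow> p \<le> measure_pmf.prob (run V E (K t)) (outputs_in G)"
    and p: "p \<le> 1" and \<tau>: "0 < \<tau>" and \<rho>: "edge_mean (\<lambda>e. exp (- real (min_degree e) / \<tau>)) \<le> \<rho>"
  shows "p - exp (1 - t / \<tau>) * \<rho> ^ s \<le> measure_pmf.prob (run V E (probe_edges s t K)) (outputs_in G)"
proof (induction s arbitrary: t)
  case 0
  show ?case
  proof (cases "\<tau> < real t")
    case True
    have "p - exp (1 - t / \<tau>) * \<rho> ^ 0 \<le> p" by simp
    also note K[OF True]
    finally show ?thesis by simp
  next
    case False
    \<comment> \<open>At or below \<tau> the Markov term is at least 1, so the claim is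
      trivial.\<close>
    then have "0 \<le> 1 - t / \<tau>" using \<tau> by simp
    then have "1 \<le> exp (1 - t / \<tau>)" by simp
    then have "p - exp (1 - t / \<tau>) * \<rho> ^ 0 \<le> 0"
      using p unfolding power_0 mult_1_right by linarith
    also have "0 \<le> measure_pmf.prob (run V E (probe_edges 0 t K)) (outputs_in G)" by simp
    finally show ?thesis .
  qed
next
  case (Suc s)
  have "0 \<le> edge_mean (\<lambda>e. exp (- real (min_degree e) / \<tau>))"
    unfolding edge_mean_def by (intro divide_nonneg_nonneg sum_nonneg) auto
  with \<rho> have \<rho>_nonneg: "0 \<le> \<rho>" by linarith
  have "p - exp (1 - t / \<tau>) * \<rho> ^ Suc s \<le>
      p - exp (1 - t / \<tau>) * \<rho> ^ s * edge_mean (\<lambda>e. exp (- real (min_degree e) / \<tau>))"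
    using mult_left_mono[OF \<rho>, of "exp (1 - t / \<tau>) * \<rho> ^ s"] \<rho>_nonneg by (simp add: mult_ac)
  also have "\<dots> = edge_mean (\<lambda>e. p - exp (1 - t / \<tau>) * \<rho> ^ s * exp (- real (min_degree e) / \<tau>))"
    by (simp only: edge_mean_simps)
  also have "\<dots> = edge_mean (\<lambda>e. p - exp (1 - real (t + min_degree e) / \<tau>) * \<rho> ^ s)"
    by (simp add: exp_diff exp_minus add_divide_distrib exp_add field_simps)
  also have "\<dots> \<le> edge_mean (\<lambda>e. measure_pmf.prob (run V E (probe_edges s (t + min_degree e) K)) (outputs_in G))"
    by (intro edge_mean_mono Suc.IH)
  also have "\<dots> = measure_pmf.prob (run V E (probe_edges (Suc s) t K)) (outputs_in G)"
    unfolding run_probe_edges prob_bind_pmf expectation_edge by simp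
  finally show ?case .
qed

text \<open>The final sum fails to exceed all bad caps with probability at most
  \<open>1 / 8\<close>, and a good cap succeeds with probability at least
  \<open>9 / 10\<close>.\<close>

lemma prob_degree_estimator_ge:
  assumes \<epsilon>: "0 < \<epsilon>" "\<epsilon> < 1"
  shows "3 / 4 \<le> success_prob \<epsilon> V E (degree_estimator \<epsilon>)"
proof -
  define s where "s = nat \<lceil>32 / \<epsilon>\<rceil>"
  define bad where "bad = {t. \<epsilon> * real t / 4 \<le> capped_mean t}"
  \<comment> \<open>The left side of the defining inequality grows linearly in \<open>t\<close>,
    while \<open>capped_mean\<close> never exceeds \<open>mean_min_degree\<close>.\<close>
  have "finite bad"
  proof (rule finite_subset)
    show "bad \<subseteq> {..nat \<lfloor>4 * mean_min_degree / \<epsilon>\<rfloor>}"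
    proof
      fix t assume "t \<in> bad"
      then have "\<epsilon> * real t / 4 \<le> mean_min_degree"
        using capped_mean_le[of t] by (simp add: bad_def)
      then have "real t \<le> 4 * mean_min_degree / \<epsilon>" using \<epsilon> by (simp add: field_simps)
      then show "t \<in> {..nat \<lfloor>4 * mean_min_degree / \<epsilon>\<rfloor>}" by (simp add: le_nat_floor)
    qed
  qed simp
  \<comment> \<open>Besides nonemptiness this makes the maximum of \<open>bad\<close> positive, as
    dividing by it requires.\<close>
  have one_bad: "1 \<in> bad"
  proof -
    have "1 = edge_mean (\<lambda>e. 1)" by simp
    also have "\<dots> \<le> capped_mean 1" unfolding capped_mean_def
      using min_degree_pos by (intro edge_mean_mono) (simp add: Suc_le_eq)
    finally show ?thesis using \<epsilon> by (simp add: bad_def)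
  qed
  text \<open>The set \<open>bad\<close> does not depend on the run, so it suffices that the final sum exceeds its
    largest element.\<close>
  define \<tau> where "\<tau> = Max bad"
  have \<tau>: "\<tau> \<in> bad" "\<And>t. t \<in> bad \<Longrightarrow> t \<le> \<tau>"
    using Max_in[of bad] \<open>finite bad\<close> one_bad by (auto simp: \<tau>_def simp del: Max_in)
  have \<tau>_pos: "0 < \<tau>" using \<tau>(2)[OF one_bad] by simp
  have "edge_mean (\<lambda>e. exp (- real (min_degree e) / \<tau>))
      \<le> edge_mean (\<lambda>e. 1 - real (min (min_degree e) \<tau>) / (2 * \<tau>))"
  proof (intro edge_mean_mono)
    fix e
    have "min (real (min_degree e) / \<tau>) 1 = real (min (min_degree e) \<tau>) / \<tau>"
      using \<tau>_pos by (auto simp: min_def field_simps)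
    then show "exp (- real (min_degree e) / \<tau>) \<le> 1 - real (min (min_degree e) \<tau>) / (2 * \<tau>)"
      using exp_minus_le[of "real (min_degree e) / \<tau>"] by simp
  qed
  also have "\<dots> = 1 - capped_mean \<tau> / (2 * \<tau>)" by (simp only: edge_mean_simps capped_mean_def)
  \<comment> \<open>Being bad helps here:
    \<open>\<epsilon> * \<tau> / 4 \<le> capped_mean \<tau>\<close> says that a probe makes progress
    on the scale \<tau>.\<close>
  also have "\<dots> \<le> 1 - \<epsilon> / 8" using \<tau>(1) \<tau>_pos by (simp add: bad_def field_simps)
  finally have \<rho>: "edge_mean (\<lambda>e. exp (- real (min_degree e) / real \<tau>)) \<le> 1 - \<epsilon> / 8" .
  have "9 / 10 - exp (1 - real 0 / \<tau>) * (1 - \<epsilon> / 8) ^ s \<le> measure_pmf.prob (run V E (degree_estimator \<epsilon>))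
      (outputs_in {(1 - \<epsilon>) * d .. (1 + \<epsilon>) * d})"
    unfolding degree_estimator_def s_def[symmetric]
  proof (intro prob_probe_edges_ge \<rho>)
    fix t assume "real \<tau> < real t"
    then have "t \<notin> bad" using \<tau>(2)[of t] by auto
    then show "9 / 10 \<le> measure_pmf.prob (run V E (sampler (40 * real t / \<epsilon>) t (Start 0 0)))
        (outputs_in {(1 - \<epsilon>) * d .. (1 + \<epsilon>) * d})"
      using \<epsilon> by (intro prob_sampler_ge) (auto simp: bad_def)
  qed (use \<tau>_pos in auto)
  moreover have "exp (1 - real 0 / \<tau>) * (1 - \<epsilon> / 8) ^ s \<le> 1 / 8"
  proof -
    have "(1 - \<epsilon> / 8) ^ s \<le> exp (- (\<epsilon> / 8)) ^ s"
      using exp_ge_add_one_self[of "- (\<epsilon> / 8)"] \<epsilon> by (intro power_mono) auto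
    also have "\<dots> = exp (- (s * \<epsilon> / 8))" by (simp flip: exp_of_nat_mult)
    also have "\<dots> \<le> exp (- 4)"
    proof -
      have "32 / \<epsilon> \<le> s" by (simp add: s_def) linarith
      then have "32 \<le> s * \<epsilon>" using \<epsilon> by (simp add: field_simps)
      then show ?thesis by simp
    qed
    finally have "exp 1 * (1 - \<epsilon> / 8) ^ s \<le> exp 1 * exp (- 4)" by simp
    also have "\<dots> = (exp (- 1)) ^ 3" by (simp flip: exp_add exp_of_nat_mult)
    also have "\<dots> \<le> (1 / 2) ^ 3"
      using exp_minus_le[of 1] by (intro power_mono) auto
    finally show ?thesis by (simp add: power3_eq_cube)
  qed
  ultimately show ?thesis unfolding success_prob_eq_prob_outputs_in by linarith
qed

text \<open>Makes \<open>sqrt (n / d)\<close> at least 1, so that it absorbs the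
  \<open>O(1 / \<epsilon>)\<close> probing queries.\<close>

lemma avg_degree_le_card: "d \<le> card V"
proof -
  have "2 * real (card E) \<le> (\<Sum>v\<in>V. real (card V))"
    unfolding sum_deg[symmetric] deg_def using edgeD finite_V
    by (intro sum_mono of_nat_mono card_mono) (auto simp: neighbors_def)
  then show ?thesis using card_V_pos by (simp add: avg_degree_def field_simps)
qed

lemma capped_cost_degree_estimator_le:
  assumes \<epsilon>: "0 < \<epsilon>" "\<epsilon> < 1"
  shows "capped_cost k (run V E (degree_estimator \<epsilon>)) \<le>
    ennreal (17235 * (\<epsilon> powr (-2) * sqrt (card V / d)))"
proof -
  define s where "s = nat \<lceil>32 / \<epsilon>\<rceil>"
  define n where "n = real (card V)"
  let ?R = mean_min_degree
  let ?c = "168 / (\<epsilon> * d)"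
  have n: "0 < n" and dn: "d \<le> n"
    using card_V_pos avg_degree_le_card by (auto simp: n_def)
  have one_le: "1 \<le> sqrt (n / d)" using dn d_pos by simp
  have s: "real s \<le> 33 / \<epsilon>" "real s + 1 \<le> 34 / \<epsilon>"
  proof -
    have "real s \<le> 32 / \<epsilon> + 1" using \<epsilon> by (simp add: s_def)
    moreover have "1 \<le> 1 / \<epsilon>" using \<epsilon> by simp
    moreover have "32 / \<epsilon> = 32 * (1 / \<epsilon>)" "33 / \<epsilon> = 33 * (1 / \<epsilon>)" "34 / \<epsilon> = 34 * (1 / \<epsilon>)" by auto
    ultimately show "real s \<le> 33 / \<epsilon>" "real s + 1 \<le> 34 / \<epsilon>" by linarith+
  qed
  have "real (card E) = n * d / 2" using n by (simp add: avg_degree_def n_def)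
  also have "\<dots> \<le> n * d" using n d_pos by simp
  finally have "?R \<le> 3 * sqrt (n * d)"
    using mean_min_degree_le by (smt (verit) real_sqrt_le_mono)
  also have "sqrt (n * d) = d * sqrt (n / d)"
    using n d_pos real_sqrt_mult[of "d * d" "n / d"] by (simp add: mult.commute)
  finally have R: "?R / d \<le> 3 * sqrt (n / d)" using d_pos by (simp add: field_simps)

  have "capped_cost k (run V E (degree_estimator \<epsilon>)) \<le> ennreal (3 * real s + ?c * (real 0 + s * ?R + ?R))"
    unfolding degree_estimator_def s_def[symmetric]
    using \<epsilon> d_pos by (intro capped_cost_probe_edges_le capped_cost_sampler_le) auto
  also have "\<dots> \<le> ennreal (17235 * (\<epsilon> powr (-2) * sqrt (card V / d)))"
  proof (intro ennreal_leI)
    have "3 * real s + ?c * (real 0 + s * ?R + ?R) = 3 * real s + 168 / \<epsilon> * (real s + 1) * (?R / d)"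
      by (simp add: field_simps)
    \<comment> \<open>The final constant is \<open>3 * 33 + 168 * 34 * 3 = 17235\<close>.\<close>
    also have "\<dots> \<le> 3 * (33 / \<epsilon>) + 168 / \<epsilon> * (34 / \<epsilon>) * (3 * sqrt (n / d))"
      using s R \<epsilon> mean_min_degree_pos d_pos by (intro add_mono mult_mono) auto
    also have "\<dots> = 99 * (1 / \<epsilon>) + 17136 * (1 / \<epsilon>\<^sup>2 * sqrt (n / d))"
      by (simp add: power2_eq_square)
    also have "1 / \<epsilon> \<le> 1 / \<epsilon>\<^sup>2 * sqrt (n / d)"
    proof -
      have "1 / \<epsilon> \<le> 1 / \<epsilon>\<^sup>2" using \<epsilon> by (simp add: field_simps power2_eq_square)
      then have "1 / \<epsilon> * 1 \<le> 1 / \<epsilon>\<^sup>2 * sqrt (n / d)"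
        using one_le \<epsilon> by (intro mult_mono) auto
      then show ?thesis by simp
    qed
    also have "99 * (1 / \<epsilon>\<^sup>2 * sqrt (n / d)) + 17136 * (1 / \<epsilon>\<^sup>2 * sqrt (n / d)) =
        17235 * (\<epsilon> powr (-2) * sqrt (card V / d))"
      using \<epsilon> by (simp add: powr_minus_divide n_def)
    finally show "3 * real s + ?c * (real 0 + s * ?R + ?R) \<le> \<dots>" by simp
  qed
  finally show ?thesis .
qed

end

lemma degree_estimator_within:
  "estimates_avg_degree_within (degree_estimator :: real \<Rightarrow> 'v::linorder algorithm)
     (\<lambda>\<epsilon> n d. \<epsilon> powr (-2) * sqrt (n / d))"
  unfolding estimates_avg_degree_within_def
proof (rule exI[of _ "3 / 4"], intro conjI, simp, rule exI[of _ 17235], intro conjI allI impI; (elim conjE)?)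
  fix \<epsilon> :: real and V :: "'v set" and E
  assume \<epsilon>: "0 < \<epsilon>" "\<epsilon> < 1" and "simple_graph V E" "no_isolated V E"
  then interpret query_graph V E by unfold_locales
  \<comment> \<open>Uniformity in the cap gives both almost sure halting and the query
    bound.\<close>
  note cost = capped_cost_degree_estimator_le[OF \<epsilon>]
  show "lossless_spmf (run V E (degree_estimator \<epsilon>))"
    by (rule lossless_if_capped_cost_bounded[OF cost])
  show "3 / 4 \<le> success_prob \<epsilon> V E (degree_estimator \<epsilon>)"
    by (rule prob_degree_estimator_ge[OF \<epsilon>])
  show "expected_queries V E (degree_estimator \<epsilon>) \<le>
      ennreal (17235 * (\<epsilon> powr (-2) * sqrt (card V / avg_degree V E)))"
    by (rule expected_queries_le_if_capped_cost_bounded[OF cost])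
qed auto

lemma estimates_avg_degree_within_mono:
  assumes "estimates_avg_degree_within A b"
    and le: "\<And>\<epsilon> n d. 0 < \<epsilon> \<Longrightarrow> \<epsilon> < 1 \<Longrightarrow> 0 \<le> n \<Longrightarrow> 0 \<le> d \<Longrightarrow> b \<epsilon> n d \<le> b' \<epsilon> n d"
  shows "estimates_avg_degree_within A b'"
proof -
  obtain p C where pC: "1 / 2 < p" "0 < C" and A: "\<And>\<epsilon> V E.
      0 < \<epsilon> \<and> \<epsilon> < 1 \<and> simple_graph V E \<and> no_isolated V E \<Longrightarrow>
        lossless_spmf (run V E (A \<epsilon>)) \<and> p \<le> success_prob \<epsilon> V E (A \<epsilon>) \<and>
        expected_queries V E (A \<epsilon>) \<le> ennreal (C * b \<epsilon> (real (card V)) (avg_degree V E))"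
    using assms(1) unfolding estimates_avg_degree_within_def by auto
  show ?thesis
    unfolding estimates_avg_degree_within_def
  proof (rule exI[of _ p], intro conjI pC, rule exI[of _ C], intro conjI pC allI impI)
    fix \<epsilon> :: real and V :: "'a set" and E
    assume asm: "0 < \<epsilon> \<and> \<epsilon> < 1 \<and> simple_graph V E \<and> no_isolated V E"
    then show "lossless_spmf (run V E (A \<epsilon>))" "p \<le> success_prob \<epsilon> V E (A \<epsilon>)" using A by auto
    have "expected_queries V E (A \<epsilon>) \<le> ennreal (C * b \<epsilon> (real (card V)) (avg_degree V E))"
      using A asm by auto
    also have "\<dots> \<le> ennreal (C * b' \<epsilon> (real (card V)) (avg_degree V E))"
      using asm pC by (intro ennreal_leI mult_left_mono le) (auto simp: avg_degree_def)
    finally show "expected_queries V E (A \<epsilon>) \<le> \<dots>" .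
  qed
qed

theorem theorem4p1:
  shows "(\<exists>A :: real \<Rightarrow> 'v::linorder algorithm.
            estimates_avg_degree_within A (\<lambda>\<epsilon> n d. \<epsilon> powr (-2.5) * sqrt (n / d))) \<and>
         (\<exists>A :: real \<Rightarrow> 'v::linorder algorithm.
            estimates_avg_degree_within A (\<lambda>\<epsilon> n d. \<epsilon> powr (-2) * sqrt (n / d)))"
proof (intro conjI exI)
  show "estimates_avg_degree_within (degree_estimator :: real \<Rightarrow> 'v algorithm)
      (\<lambda>\<epsilon> n d. \<epsilon> powr (-2.5) * sqrt (n / d))"
    \<comment> \<open>As \<open>\<epsilon> < 1\<close>, the smaller exponent gives the larger
      bound.\<close>
    by (rule estimates_avg_degree_within_mono[OF degree_estimator_within])
       (auto intro!: mult_right_mono powr_mono')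
qed (rule degree_estimator_within)

end
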